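(* Let $k$ and $l$ be positive integers with $l \geq k \geq 3$; let $n_1,\ldots, n_k$ be positive integers such that $n_1 \geq \cdots \geq n_k$; and let $n'_1, \ldots ,n'_l$ be positive integers such that $n'_1 \geq \cdots \geq n'_l$ and $n'_1 \geq n_1$, $n'_2 \geq n_2$, $\ldots$, $n'_k \geq n_k$. If $K_{n_1,\ldots,n_k}$ is competitively orientable, then $K_{n'_1,\ldots,n'_l}$ is also competitively orientable.
   Context: All graphs are finite and simple. An orientation of a graph $G$ is a digraph $D$ on the vertex set $V(G)$ with no loops, no multiple arcs and no directed $2$-cycles, whose underlying graph (with edge set $\{uv \mid (u,v)\in A(D)\}$) is $G$. A digraph $D$ is competitive if every pair of distinct vertices $x,y$ has a common out-neighbor, i.e. there is a vertex $z$ with $(x,z),(y,z)\in A(D)$. A graph is competitively orientable if it has a competitive orientation. $K_{n_1,\ldots,n_k}$ denotes the complete $k$-partite graph with partite sets of sizes $n_1,\ldots,n_k$. *)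

theory Defs
  imports "Graph_Theory.Digraph_Component"
begin

text \<open>
  Following the Graph-Theory library, a finite simple graph is a \<^term>\<open>pair_graph\<close>: the edge
  \<open>uv\<close> is represented by the two arcs \<open>(u, v)\<close> and \<open>(v, u)\<close>. Accordingly \<^term>\<open>mk_symmetric D\<close>
  is the underlying graph of the digraph \<open>D\<close>. Multiple arcs are excluded by the type of
  \<open>D\<close>, and loops by \<^term>\<open>pair_digraph\<close>.
\<close>

definition orientation_of :: "'a pair_pre_digraph \<Rightarrow> 'a pair_pre_digraph \<Rightarrow> bool" where
  "orientation_of D G \<longleftrightarrow>
     pair_digraph D \<and>
     (\<forall>u v. (u, v) \<in> parcs D \<longrightarrow> (v, u) \<notin> parcs D) \<and>
     mk_symmetric D = G"

definition competitive :: "'a pair_pre_digraph \<Rightarrow> bool" where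
  "competitive D \<longleftrightarrow>
     (\<forall>x \<in> pverts D. \<forall>y \<in> pverts D. x \<noteq> y \<longrightarrow>
        (\<exists>z \<in> pverts D. (x, z) \<in> parcs D \<and> (y, z) \<in> parcs D))"

definition competitively_orientable :: "'a pair_pre_digraph \<Rightarrow> bool" where
  "competitively_orientable G \<longleftrightarrow> (\<exists>D. orientation_of D G \<and> competitive D)"

text \<open>
  The vertex \<open>(i, j)\<close> is the \<open>j\<close>-th vertex of the \<open>i\<close>-th partite set. Only the values
  \<open>n 1, \<dots>, n k\<close> of \<open>n\<close> are used.
\<close>

definition complete_multipartite :: "nat \<Rightarrow> (nat \<Rightarrow> nat) \<Rightarrow> (nat \<times> nat) pair_pre_digraph" where
  "complete_multipartite k n =
     \<lparr> pverts = (SIGMA i:{1..k}. {1..n i}),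
       parcs = {(u, v). u \<in> (SIGMA i:{1..k}. {1..n i}) \<and> v \<in> (SIGMA i:{1..k}. {1..n i}) \<and>
                        fst u \<noteq> fst v} \<rparr>"

lemma pair_graph_complete_multipartite: "pair_graph (complete_multipartite k n)"
proof -
  let ?V = "SIGMA i:{1..k}. {1..n i}"
  have "finite ?V" by simp
  moreover have "{(u, v). u \<in> ?V \<and> v \<in> ?V \<and> fst u \<noteq> fst v} \<subseteq> ?V \<times> ?V" by blast
  ultimately have "finite {(u, v). u \<in> ?V \<and> v \<in> ?V \<and> fst u \<noteq> fst v}"
    using finite_subset finite_cartesian_product by blast
  then show ?thesis
    by unfold_locales (auto simp: complete_multipartite_def symmetric_def sym_def)
qed

end

theory Submission
  imports Defs
begin

text \<open>
  Twin vertices, with the same in- and out-neighbours, may be added to a partite set: a twin and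
  its original share every out-neighbour of the original, and one exists as soon as there are two
  vertices. A new partite set may be added with all arcs directed from it to the old vertices: it
  then shares every out-neighbour of each old vertex. The orientation \<open>blow_up\<close> does both at once,
  collapsing twins by means of \<open>(i, j) \<mapsto> (i, min j (n i))\<close>.
\<close>

definition blow_up_arc ::
  "nat \<Rightarrow> (nat \<Rightarrow> nat) \<Rightarrow> ((nat \<times> nat) \<times> (nat \<times> nat)) set \<Rightarrow> nat \<times> nat \<Rightarrow> nat \<times> nat \<Rightarrow> bool" where
  "blow_up_arc k n A u v \<longleftrightarrow>
     (if fst u \<le> k \<and> fst v \<le> k
      then ((fst u, min (snd u) (n (fst u))), (fst v, min (snd v) (n (fst v)))) \<in> A
      else fst v < fst u)"

definition blow_up :: "nat \<Rightarrow> (nat \<Rightarrow> nat) \<Rightarrow> nat \<Rightarrow> (nat \<Rightarrow> nat) \<Rightarrow> (nat \<times> nat) pair_pre_digraph \<Rightarrow>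
    (nat \<times> nat) pair_pre_digraph" where
  "blow_up k n l n' D =
     \<lparr> pverts = (SIGMA i:{1..l}. {1..n' i}),
       parcs = {(u, v). u \<in> (SIGMA i:{1..l}. {1..n' i}) \<and> v \<in> (SIGMA i:{1..l}. {1..n' i}) \<and>
                        blow_up_arc k n (parcs D) u v} \<rparr>"

lemma mem_parcs_mk_symmetric:
  fixes D :: "'a pair_pre_digraph"
  shows "(u, v) \<in> parcs (mk_symmetric D) \<longleftrightarrow> (u, v) \<in> parcs D \<or> (v, u) \<in> parcs D"
  unfolding parcs_mk_symmetric by (auto simp: Bex_def)

text \<open>Reduces being an orientation to a check on pairs of vertices, so that the blow-up can be
  tested pair by pair. Asymmetry on vertices is enough because all arcs lie between
  vertices.\<close>

lemma orientation_of_complete_multipartite_iff: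
  "orientation_of D (complete_multipartite k n) \<longleftrightarrow>
     pverts D = (SIGMA i:{1..k}. {1..n i}) \<and>
     parcs D \<subseteq> pverts D \<times> pverts D \<and>
     (\<forall>u \<in> pverts D. \<forall>v \<in> pverts D.
        ((u, v) \<in> parcs D \<or> (v, u) \<in> parcs D \<longleftrightarrow> fst u \<noteq> fst v) \<and>
        ((u, v) \<in> parcs D \<longrightarrow> (v, u) \<notin> parcs D))"
  (is "?L \<longleftrightarrow> ?R")
proof
  assume L: ?L
  then interpret pair_digraph D by (simp add: orientation_of_def)
  have V: "pverts D = (SIGMA i:{1..k}. {1..n i})"
    using L by (auto simp: orientation_of_def complete_multipartite_def mk_symmetric_def)
  have "parcs (mk_symmetric D) = parcs (complete_multipartite k n)"
    using L by (simp add: orientation_of_def)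
  then have "(u, v) \<in> parcs (mk_symmetric D) \<longleftrightarrow> (u, v) \<in> parcs (complete_multipartite k n)" for u v
    by simp
  then have A: "(u, v) \<in> parcs D \<or> (v, u) \<in> parcs D \<longleftrightarrow>
      u \<in> pverts D \<and> v \<in> pverts D \<and> fst u \<noteq> fst v" for u v
    unfolding mem_parcs_mk_symmetric V by (simp add: complete_multipartite_def)
  have "parcs D \<subseteq> pverts D \<times> pverts D"
    by (auto dest: in_arcsD1 in_arcsD2)
  moreover have "\<forall>u v. (u, v) \<in> parcs D \<longrightarrow> (v, u) \<notin> parcs D"
    using L by (simp add: orientation_of_def)
  ultimately show ?R
    using V A by blast
next
  assume R: ?R
  then have V: "pverts D = (SIGMA i:{1..k}. {1..n i})"
    and sub: "parcs D \<subseteq> pverts D \<times> pverts D"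
    and A: "\<And>u v. u \<in> pverts D \<Longrightarrow> v \<in> pverts D \<Longrightarrow>
      (u, v) \<in> parcs D \<or> (v, u) \<in> parcs D \<longleftrightarrow> fst u \<noteq> fst v"
    and asym: "\<And>u v. (u, v) \<in> parcs D \<Longrightarrow> (v, u) \<notin> parcs D"
    by blast+
  have fin: "finite (pverts D)" by (simp add: V)
  have "pair_digraph D"
  proof
    show "finite (parcs D)"
      using finite_subset[OF sub] fin by simp
    \<comment> \<open>A loop is its own reverse, so asymmetry excludes it.\<close>
    show "fst e \<noteq> snd e" if "e \<in> parcs D" for e
      using that asym[of "fst e" "snd e"] by (metis prod.collapse)
  qed (use sub fin in auto)
  moreover have "mk_symmetric D = complete_multipartite k n"
  proof (rule pair_pre_digraph.equality)
    have "(u, v) \<in> parcs (mk_symmetric D) \<longleftrightarrow>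
        u \<in> pverts D \<and> v \<in> pverts D \<and> fst u \<noteq> fst v" for u v
      unfolding mem_parcs_mk_symmetric using sub A by blast
    then show "parcs (mk_symmetric D) = parcs (complete_multipartite k n)"
      unfolding V by (simp add: complete_multipartite_def set_eq_iff split_paired_all)
  qed (simp_all add: V complete_multipartite_def)
  ultimately show ?L
    using asym by (auto simp: orientation_of_def)
qed

text \<open>Covers the case \<open>x = y\<close>, which arises when twins collapse to one vertex:
  one of \<open>u\<close>, \<open>v\<close> differs from \<open>x\<close>, and its common
  out-neighbor with \<open>x\<close> serves.\<close>

lemma competitive_outneighbor:
  assumes "competitive D" "u \<in> pverts D" "v \<in> pverts D" "v \<noteq> u" "x \<in> pverts D" "y \<in> pverts D"
  shows "\<exists>z \<in> pverts D. (x, z) \<in> parcs D \<and> (y, z) \<in> parcs D"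
  using assms unfolding competitive_def by metis

text \<open>Collapsing twins preserves the first coordinate, so between old parts both adjacency and
  asymmetry pull back from \<open>D\<close>.\<close>

lemma orientation_of_blow_up:
  assumes D: "orientation_of D (complete_multipartite k n)"
    and pos: "\<And>i. i \<in> {1..k} \<Longrightarrow> n i > 0"
  shows "orientation_of (blow_up k n l n' D) (complete_multipartite l n')"
proof -
  have V: "pverts D = (SIGMA i:{1..k}. {1..n i})"
    and A: "\<And>u v. u \<in> pverts D \<Longrightarrow> v \<in> pverts D \<Longrightarrow>
      (u, v) \<in> parcs D \<or> (v, u) \<in> parcs D \<longleftrightarrow> fst u \<noteq> fst v"
    and asym: "\<And>u v. u \<in> pverts D \<Longrightarrow> v \<in> pverts D \<Longrightarrow> (u, v) \<in> parcs D \<Longrightarrow> (v, u) \<notin> parcs D"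
    using D by (auto simp: orientation_of_complete_multipartite_iff)
  let ?V = "SIGMA i:{1..l}. {1..n' i}" and ?f = "\<lambda>u. (fst u, min (snd u) (n (fst u)))"
  \<comment> \<open>Second coordinates start at 1, so positivity of \<open>n\<close> keeps the
    minimum in range.\<close>
  have f: "?f u \<in> pverts D" if "u \<in> ?V" "fst u \<le> k" for u
    using that pos[of "fst u"] by (auto simp: V)
  have "(blow_up_arc k n (parcs D) u v \<or> blow_up_arc k n (parcs D) v u \<longleftrightarrow> fst u \<noteq> fst v) \<and>
      (blow_up_arc k n (parcs D) u v \<longrightarrow> \<not> blow_up_arc k n (parcs D) v u)"
    if "u \<in> ?V" "v \<in> ?V" for u v
  proof (cases "fst u \<le> k \<and> fst v \<le> k")
    case True
    then have "?f u \<in> pverts D" "?f v \<in> pverts D"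
      using f that by blast+
    with A[of "?f u" "?f v"] asym[of "?f u" "?f v"] True show ?thesis
      by (simp add: blow_up_arc_def)
  next
    \<comment> \<open>With a new part involved, arcs run from the larger part index to the smaller;
      this also settles pairs of vertices in two new parts.\<close>
    case False
    then show ?thesis by (auto simp: blow_up_arc_def)
  qed
  then show ?thesis
    by (auto simp: orientation_of_complete_multipartite_iff blow_up_def)
qed

lemma competitive_blow_up:
  assumes D: "orientation_of D (complete_multipartite k n)" "competitive D"
    and "k \<ge> 2" "l \<ge> k"
    and pos: "\<And>i. i \<in> {1..k} \<Longrightarrow> n i > 0"
    and le: "\<And>i. i \<in> {1..k} \<Longrightarrow> n i \<le> n' i"
  shows "competitive (blow_up k n l n' D)"
proof -
  have V: "pverts D = (SIGMA i:{1..k}. {1..n i})"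
    using D by (auto simp: orientation_of_complete_multipartite_iff)
  let ?V = "SIGMA i:{1..l}. {1..n' i}"
  \<comment> \<open>The out-neighbours in \<open>D\<close> of a vertex of a new partite set are all the vertices of \<open>D\<close>, so
    any vertex of \<open>D\<close> may stand for it.\<close>
  let ?f = "\<lambda>u. if fst u \<le> k then (fst u, min (snd u) (n (fst u))) else (1, 1)"
  \<comment> \<open>Two distinct vertices are taken from different parts, since every part may be a
    singleton.\<close>
  have two: "(1, 1) \<in> pverts D" "(2, 1) \<in> pverts D"
    using \<open>k \<ge> 2\<close> pos[of 1] pos[of 2] by (auto simp: V)
  \<comment> \<open>Here the part sizes are compared: a vertex of \<open>D\<close> is a vertex of
    the blow-up.\<close>
  have sub: "z \<in> ?V" if "z \<in> pverts D" for z
    using that \<open>l \<ge> k\<close> le[of "fst z"] by (auto simp: V)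
  have f: "?f u \<in> pverts D" if "u \<in> ?V" for u
    using that two pos[of "fst u"] by (auto simp: V)
  \<comment> \<open>A vertex \<open>z\<close> of \<open>D\<close> is fixed by the collapse, so for
    old \<open>u\<close> the arc is the given one; for new \<open>u\<close> it holds because
    \<open>fst z \<le> k < fst u\<close>.\<close>
  have arc: "blow_up_arc k n (parcs D) u z"
    if "z \<in> pverts D" "(?f u, z) \<in> parcs D" for u z
    using that by (auto simp: blow_up_arc_def V min_def split: if_splits)
  show ?thesis
    unfolding competitive_def
  proof (intro ballI impI)
    fix x y assume "x \<in> pverts (blow_up k n l n' D)" "y \<in> pverts (blow_up k n l n' D)"
    then have xy: "x \<in> ?V" "y \<in> ?V" by (simp_all add: blow_up_def)
    \<comment> \<open>The images of \<open>x\<close> and \<open>y\<close> may coincide, as for twins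
      or two vertices of new parts.\<close>
    obtain z where "z \<in> pverts D" "(?f x, z) \<in> parcs D" "(?f y, z) \<in> parcs D"
      using competitive_outneighbor[OF D(2) two _ f[OF xy(1)] f[OF xy(2)]] by auto
    then show "\<exists>z \<in> pverts (blow_up k n l n' D). (x, z) \<in> parcs (blow_up k n l n' D) \<and>
        (y, z) \<in> parcs (blow_up k n l n' D)"
      using xy sub arc unfolding blow_up_def by (intro bexI[of _ z]) simp_all
  qed
qed

theorem corollary2p7:
  fixes k l :: nat and n n' :: "nat \<Rightarrow> nat"
  assumes "k \<ge> 3" and "l \<ge> k"
    and "\<forall>i \<in> {1..k}. n i > 0"
    and "\<forall>i \<in> {1..k}. \<forall>j \<in> {1..k}. i \<le> j \<longrightarrow> n i \<ge> n j"
    and "\<forall>i \<in> {1..l}. n' i > 0"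
    and "\<forall>i \<in> {1..l}. \<forall>j \<in> {1..l}. i \<le> j \<longrightarrow> n' i \<ge> n' j"
    and "\<forall>i \<in> {1..k}. n' i \<ge> n i"
    and "competitively_orientable (complete_multipartite k n)"
  shows "competitively_orientable (complete_multipartite l n')"
proof -
  obtain D where D: "orientation_of D (complete_multipartite k n)" "competitive D"
    using assms(8) by (auto simp: competitively_orientable_def)
  have "orientation_of (blow_up k n l n' D) (complete_multipartite l n')"
    using D(1) assms(3) by (intro orientation_of_blow_up) auto
  moreover have "competitive (blow_up k n l n' D)"
    using D assms(1-3,7) by (intro competitive_blow_up) auto
  ultimately show ?thesis
    by (auto simp: competitively_orientable_def)
qed

end
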